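(* Let $q\ge 3$ be odd. If $F_q$ has a cycle of period $p$ with seed $$x_0=X_q(h+\lambda_h q)=2(q-1)(h+\lambda_h q)+1,\qquad h\in\{1,\ldots,q-1\},\ \lambda_h\in\mathbb N,$$ then $q$ must be a divisor of $M=h2^k-1$ for the positive integer $k=p-g(0)$, where $g(0)$ is the index of the last entry equal to $1$ in the parity vector of the cycle. Furthermore, if $h=1$ (trivial cycle) or $h$ is a power of $2$, then $q$ must be a Mersenne number or a factor of a Mersenne number $M_m=2^m-1$, $1<m\in\mathbb Z^+$.
   Context: $\mathbb Z^+$ is the set of positive integers and $\mathbb N=\{0,1,2,\ldots\}$. For odd $q\ge 3$ let $X_q(n)=2(q-1)n+1$ for $n\in\mathbb Z^+$, and let $\mathbb Z_{cq}=X_q(\mathbb Z^+)=\{x\in\mathbb Z^+ : x\equiv 1 \bmod 2(q-1),\ x>1\}$. For $x\in\mathbb Z_{cq}$ let $\alpha_q(x)=1$ if $x-1\equiv 2(q-1) \pmod{4(q-1)}$ and $\alpha_q(x)=0$ if $x-1\equiv 0\pmod{4(q-1)}$, and define $F_q:\mathbb Z_{cq}\to\mathbb Z_{cq}$ by $F_q(x)=\frac{q^{\alpha_q(x)}}{2}(x+1)$. A cycle of $F_q$ of period $p\in\mathbb Z^+$ is a periodic sequence $\{x_0,x_1,\ldots,x_{p-1}\}$ in $\mathbb Z_{cq}$ with $x_j=F_q^j(x_0)$ and $x_{j+p}=x_j$, where $p$ is the minimum possible period and the seed $x_0$ is, by convention, the minimum element of the cycle. Its parity vector is $\mathbf A_p=(\alpha^0,\ldots,\alpha^{p-1})$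 with $\alpha^j=\alpha_q(x_j)$; the index $g(0)\in\{0,\ldots,p-1\}$ is characterised by $\sum_{s=g(0)}^{p-1}\alpha^s=1$ and $\sum_{s=g(0)+1}^{p-1}\alpha^s=0$. *)

theory Defs
  imports Main "HOL-Number_Theory.Cong"
begin

definition X :: "nat \<Rightarrow> nat \<Rightarrow> nat" where
  "X q n = 2 * (q - 1) * n + 1"

definition Zc :: "nat \<Rightarrow> nat set" where
  "Zc q = X q ` {n. 0 < n}"

text \<open>Only the values on \<open>Zc q\<close> matter for \<open>alpha q\<close> and \<open>F q\<close>. There \<open>x\<close> is odd and
  \<open>x > 1\<close>, so neither the subtraction nor the division by 2 truncates (see \<open>two_times_F\<close>),
  and \<open>x - 1\<close> is congruent to \<open>2 * (q - 1)\<close> or to 0 modulo \<open>4 * (q - 1)\<close>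
  (see \<open>alpha_X\<close>).\<close>

definition alpha :: "nat \<Rightarrow> nat \<Rightarrow> nat" where
  "alpha q x = (if [x - 1 = 2 * (q - 1)] (mod 4 * (q - 1)) then 1 else 0)"

definition F :: "nat \<Rightarrow> nat \<Rightarrow> nat" where
  "F q x = q ^ alpha q x * (x + 1) div 2"

lemma Zc_eq:
  assumes "q \<ge> 3"
  shows "Zc q = {x. [x = 1] (mod 2 * (q - 1)) \<and> x > 1}"
proof (intro set_eqI iffI)
  fix x assume "x \<in> Zc q"
  then obtain n where n: "x = X q n" "n > 0" by (auto simp: Zc_def)
  have "x > 1" using n assms by (simp add: X_def)
  moreover have "2 * (q - 1) dvd x - 1" using n by (simp add: X_def)
  ultimately show "x \<in> {x. [x = 1] (mod 2 * (q - 1)) \<and> x > 1}"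
    using cong_altdef_nat[of 1 x] by auto
next
  fix x assume "x \<in> {x. [x = 1] (mod 2 * (q - 1)) \<and> x > 1}"
  then have x: "x > 1" "2 * (q - 1) dvd x - 1"
    by (auto simp: cong_altdef_nat)
  then obtain n where "x - 1 = 2 * (q - 1) * n" by blast
  with x have "x = X q n" "n > 0" by (auto simp: X_def intro: gr0I)
  then show "x \<in> Zc q" by (auto simp: Zc_def)
qed

lemma alpha_X:
  assumes "q \<ge> 3"
  shows "alpha q (X q n) = (if odd n then 1 else 0)"
    and "alpha q (X q n) = 0 \<longleftrightarrow> [X q n - 1 = 0] (mod 4 * (q - 1))"
proof -
  have eq: "(2 * (q - 1)) * n mod (2 * (q - 1) * 2) = 2 * (q - 1) * (n mod 2)"
    by (rule mult_mod_right [symmetric])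
  have m: "4 * (q - 1) = 2 * (q - 1) * 2" by simp
  have less: "2 * (q - 1) < 2 * (q - 1) * 2" using assms by simp
  show "alpha q (X q n) = (if odd n then 1 else 0)"
    using assms less unfolding alpha_def X_def cong_def m add_diff_cancel_right' eq
    by (cases "even n") (auto simp: odd_iff_mod_2_eq_one)
  then show "alpha q (X q n) = 0 \<longleftrightarrow> [X q n - 1 = 0] (mod 4 * (q - 1))"
    using assms unfolding X_def cong_def m add_diff_cancel_right' eq
    by (auto simp: even_iff_mod_2_eq_zero)
qed

lemma two_times_F: "x \<in> Zc q \<Longrightarrow> 2 * F q x = q ^ alpha q x * (x + 1)"
  by (auto simp: F_def Zc_def X_def)

lemma F_X:
  assumes "odd q" "q \<ge> 3"
  shows "F q (X q n) = X q (if odd n then (q * n + 1) div 2 else n div 2)"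
proof (cases "odd n")
  case True
  with assms(1) have e: "2 * ((q * n + 1) div 2) = q * n + 1" by simp
  obtain r where r: "q = Suc r" using assms by (cases q) auto
  have "2 * F q (X q n) = q * (X q n + 1)"
    using True assms alpha_X(1)[OF assms(2), of n] two_times_F[of "X q n" q]
    by (auto simp: Zc_def odd_pos)
  also have "\<dots> = 2 * X q ((q * n + 1) div 2)"
    using arg_cong[OF e, of "\<lambda>t. 2 * (r * t)"] by (simp add: X_def r algebra_simps)
  finally show ?thesis using True by simp
next
  case False
  then have "F q (X q n) = (X q n + 1) div 2"
    by (simp add: F_def alpha_X(1)[OF assms(2)])
  with False show ?thesis by (auto simp: X_def elim!: evenE)
qed

lemma F_in_Zc:
  assumes "odd q" "q \<ge> 3" "x \<in> Zc q"
  shows "F q x \<in> Zc q"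
proof -
  from assms(3) obtain n where n: "x = X q n" "n > 0" by (auto simp: Zc_def)
  have "(if odd n then (q * n + 1) div 2 else n div 2) > 0"
    using n(2) assms(1,2) by (auto elim!: evenE oddE)
  then show ?thesis using F_X[OF assms(1,2)] n(1) by (auto simp: Zc_def)
qed

text \<open>A cycle is given by its periodic sequence, indexed by all of \<open>nat\<close>.\<close>

definition is_cycle :: "nat \<Rightarrow> nat \<Rightarrow> (nat \<Rightarrow> nat) \<Rightarrow> bool" where
  "is_cycle q p x \<longleftrightarrow>
     0 < p \<and>
     (\<forall>j. x j \<in> Zc q) \<and>
     (\<forall>j. x j = (F q ^^ j) (x 0)) \<and>
     (\<forall>j. x (j + p) = x j) \<and>
     (\<forall>r>0. (\<forall>j. x (j + r) = x j) \<longrightarrow> p \<le> r) \<and>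
     (\<forall>j<p. x 0 \<le> x j)"

definition last_one :: "nat \<Rightarrow> nat \<Rightarrow> (nat \<Rightarrow> nat) \<Rightarrow> nat" where
  "last_one q p x =
     (THE g. g < p \<and> (\<Sum>s = g..<p. alpha q (x s)) = 1 \<and> (\<Sum>s = g + 1..<p. alpha q (x s)) = 0)"

definition mersenne :: "nat \<Rightarrow> nat" where
  "mersenne m = 2 ^ m - 1"

end

theory Submission
  imports Defs
begin

text \<open>
  Write \<open>x\<^sub>j = X q (n\<^sub>j)\<close>. In the coordinate \<open>n\<close> the map \<open>F q\<close> is the \<open>qn + 1\<close> map: an odd \<open>n\<close>
  goes to \<open>(qn + 1)/2\<close>, an even \<open>n\<close> to \<open>n/2\<close>, and \<open>alpha q\<close> is the parity of \<open>n\<close>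
  (\<open>F_X\<close>, \<open>alpha_X\<close>). If \<open>g\<close> is the index of the last odd term of a period, then every step
  after \<open>g\<close> is a halving, and the cycle closes up at \<open>n\<^sub>p = n\<^sub>0\<close>. Unwinding these \<open>p - g - 1\<close>
  halvings and the one odd step gives \<open>q n\<^sub>g + 1 = 2\<^sup>k n\<^sub>0\<close> with \<open>k = p - g\<close>
  (\<open>odd_step_then_halvings\<close>). Modulo \<open>q\<close> the seed index \<open>n\<^sub>0 = h + lq\<close> is \<open>h\<close>, so
  \<open>q\<close> divides \<open>h 2\<^sup>k - 1\<close>. An odd term exists, since a period made of halvings alone
  would strictly decrease the positive number \<open>n\<^sub>0\<close>.

  If \<open>h = 2\<^sup>j\<close>, where \<open>j = 0\<close> is the case \<open>h = 1\<close>, then \<open>h 2\<^sup>k - 1\<close> is itself the Mersenne number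
  of exponent \<open>j + k\<close>. That exponent exceeds 1 because \<open>q \<ge> 3\<close> does not divide \<open>2 - 1\<close>.
\<close>

lemma X_eq_iff: "q \<ge> 3 \<Longrightarrow> X q m = X q n \<longleftrightarrow> m = n"
  by (simp add: X_def)

text \<open>The two sums in \<open>last_one\<close> differ by the entry at \<open>g\<close>, so together they say that this entry
  is 1 and that only zeros follow it. Of two such positions, the larger
  would carry both a 1 and a 0, which gives the uniqueness that \<open>THE\<close> needs.\<close>

lemma last_one_eqI:
  assumes "g < p" and "alpha q (x g) = 1"
    and zero: "\<And>s. g < s \<Longrightarrow> s < p \<Longrightarrow> alpha q (x s) = 0"
  shows "last_one q p x = g"
  unfolding last_one_def
proof (rule the_equality)
  show "g < p \<and> (\<Sum>s = g..<p. alpha q (x s)) = 1 \<and> (\<Sum>s = g + 1..<p. alpha q (x s)) = 0"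
    using assms by (simp add: sum.atLeast_Suc_lessThan)
next
  fix g' assume g': "g' < p \<and> (\<Sum>s = g'..<p. alpha q (x s)) = 1
    \<and> (\<Sum>s = g' + 1..<p. alpha q (x s)) = 0"
  then have "alpha q (x g') = 1"
    using sum.atLeast_Suc_lessThan[of g' p "\<lambda>s. alpha q (x s)"] by simp
  moreover have "\<And>s. g' < s \<Longrightarrow> s < p \<Longrightarrow> alpha q (x s) = 0"
    using g' by simp
  ultimately show "g' = g"
    using g' assms by (metis linorder_neqE_nat zero_neq_one)
qed

lemma halvings:
  fixes n :: "nat \<Rightarrow> nat"
  assumes "a \<le> b" and "\<And>s. a \<le> s \<Longrightarrow> s < b \<Longrightarrow> 2 * n (Suc s) = n s"
  shows "n a = 2 ^ (b - a) * n b"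
  using assms
proof (induction b rule: dec_induct)
  case (step b)
  then have "n a = 2 ^ (b - a) * n b"
    by simp
  also have "n b = 2 * n (Suc b)"
    using step.prems[of b] step.hyps by simp
  finally show ?case
    using step.hyps by (simp add: Suc_diff_le)
qed simp

text \<open>The odd step doubles to \<open>q * n g + 1\<close>, so it contributes a factor 2 just as each of the
  later halvings does; this is why the exponent is \<open>p - g\<close> and not \<open>p - g - 1\<close>.\<close>

lemma odd_step_then_halvings:
  fixes n :: "nat \<Rightarrow> nat"
  assumes "g < p" and "2 * n (Suc g) = q * n g + 1"
    and "\<And>s. g < s \<Longrightarrow> s < p \<Longrightarrow> 2 * n (Suc s) = n s"
  shows "q * n g + 1 = 2 ^ (p - g) * n p"
proof -
  have "n (Suc g) = 2 ^ (p - Suc g) * n p"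
    by (rule halvings) (use assms(1,3) in auto)
  then have "q * n g + 1 = 2 ^ Suc (p - Suc g) * n p"
    using assms(2) by simp
  then show ?thesis
    using \<open>g < p\<close> by (simp add: Suc_diff_Suc)
qed

text \<open>The map \<open>X q\<close> is injective, so a cycle of \<open>F q\<close> is the image of a closed orbit of the
  \<open>qn + 1\<close> map, and the whole argument can be carried out on that orbit.\<close>

lemma cycle_indices:
  assumes "q \<ge> 3" "odd q" "is_cycle q p x"
  obtains n where "\<And>j. x j = X q (n j)" "\<And>j. n j > 0" "n p = n 0"
    "\<And>j. n (Suc j) = (if odd (n j) then (q * n j + 1) div 2 else n j div 2)"
proof -
  have in_Zc: "\<forall>j. x j \<in> Zc q"
    using assms(3) unfolding is_cycle_def by (elim conjE)
  have orbit: "\<forall>j. x j = (F q ^^ j) (x 0)"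
    using assms(3) unfolding is_cycle_def by (elim conjE)
  have periodic: "\<forall>j. x (j + p) = x j"
    using assms(3) unfolding is_cycle_def by (elim conjE)
  have "\<forall>j. \<exists>m. x j = X q m \<and> m > 0"
    using in_Zc by (auto simp: Zc_def)
  then obtain n where n: "\<And>j. x j = X q (n j)" "\<And>j. n j > 0"
    by metis
  have closes: "n p = n 0"
    using spec[OF periodic, of 0] n(1) X_eq_iff[OF assms(1)] by simp
  have rec: "n (Suc j) = (if odd (n j) then (q * n j + 1) div 2 else n j div 2)" for j
  proof -
    have "x (Suc j) = F q ((F q ^^ j) (x 0))"
      using spec[OF orbit, of "Suc j"] by simp
    then have "x (Suc j) = F q (x j)"
      unfolding spec[OF orbit, of j, symmetric] .
    then show ?thesis
      by (simp only: n(1) F_X[OF assms(2,1)] X_eq_iff[OF assms(1)])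
  qed
  show thesis
    by (rule that[OF n closes rec])
qed

text \<open>This is the relation \<open>q n\<^sub>g + 1 = 2\<^sup>k N\<close> for a cycle that starts at \<open>X q N\<close>. The witness \<open>m\<close>
  is the index \<open>n\<^sub>g\<close> of the last odd step; only its existence matters for the residue of
  \<open>2\<^sup>k N\<close> modulo \<open>q\<close>.\<close>

lemma cycle_relation:
  assumes "q \<ge> 3" "odd q" "is_cycle q p x" "x 0 = X q N"
  shows "last_one q p x < p" and "\<exists>m. q * m + 1 = 2 ^ (p - last_one q p x) * N"
proof -
  obtain n where n: "\<And>j. x j = X q (n j)" "\<And>j. n j > 0" "n p = n 0"
    and rec: "\<And>j. n (Suc j) = (if odd (n j) then (q * n j + 1) div 2 else n j div 2)"
    using cycle_indices[OF assms(1-3)] by blast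
  have N: "n 0 = N"
    using n(1)[of 0] assms(1,4) X_eq_iff by simp
  have "p > 0"
    using assms(3) unfolding is_cycle_def by (elim conjE)
  have alpha: "alpha q (x s) = (if odd (n s) then 1 else 0)" for s
    using n(1) alpha_X(1)[OF assms(1)] by simp
  have even_step: "2 * n (Suc s) = n s" if "even (n s)" for s
    using that rec by simp
  have "\<exists>s<p. odd (n s)"
  proof (rule ccontr)
    assume "\<not> (\<exists>s<p. odd (n s))"
    then have "n 0 = 2 ^ (p - 0) * n p"
      by (intro halvings) (auto intro: even_step)
    then have "2 ^ p * n p = n p"
      using n(3) by (metis diff_zero)
    moreover have "1 < (2::nat) ^ p"
      using \<open>p > 0\<close> by (intro one_less_power) simp_all
    then have "1 * n p < 2 ^ p * n p"
      using n(2) by (rule mult_strict_right_mono)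
    ultimately show False by linarith
  qed
  then have S: "finite {s. s < p \<and> odd (n s)}" "{s. s < p \<and> odd (n s)} \<noteq> {}"
    by auto
  define g where "g = Max {s. s < p \<and> odd (n s)}"
  have g: "g < p" "odd (n g)"
    using Max_in[OF S] by (auto simp: g_def)
  have after: "even (n s)" if "g < s" "s < p" for s
  proof (rule ccontr)
    assume "odd (n s)"
    then have "s \<le> g"
      unfolding g_def using S(1) that(2) by (intro Max_ge) auto
    with that(1) show False by simp
  qed
  have last: "last_one q p x = g"
    using g after by (intro last_one_eqI) (auto simp: alpha)
  have "q * n g + 1 = 2 ^ (p - g) * n p"
  proof (rule odd_step_then_halvings)
    show "2 * n (Suc g) = q * n g + 1"
      using g(2) assms(2) rec[of g] by simp
  qed (auto intro: g(1) even_step after)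
  then show "\<exists>m. q * m + 1 = 2 ^ (p - last_one q p x) * N"
    unfolding last n(3) N by (rule exI)
  show "last_one q p x < p"
    unfolding last by (rule g(1))
qed

theorem lemma12:
  fixes q p h l k :: nat and x :: "nat \<Rightarrow> nat"
  assumes "q \<ge> 3" and "odd q"
    and "is_cycle q p x"
    and "h \<in> {1..q - 1}"
    and "x 0 = X q (h + l * q)"
    and "k = p - last_one q p x"
  shows "0 < k \<and> q dvd h * 2 ^ k - 1 \<and>
    (h = 1 \<or> (\<exists>j. h = 2 ^ j) \<longrightarrow>
      (\<exists>m>1. q = mersenne m) \<or> (\<exists>m>1. q dvd mersenne m))"
proof -
  note rel = cycle_relation[OF assms(1,2,3,5)]
  have k: "0 < k"
    using rel(1) assms(6) by simp
  obtain m where m: "q * m + 1 = 2 ^ k * (h + l * q)"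
    using rel(2) assms(6) by blast
  then have "h * 2 ^ k - 1 = q * m - q * (l * 2 ^ k)"
    by (simp add: algebra_simps)
  then have dvd: "q dvd h * 2 ^ k - 1"
    by simp
  have "\<exists>m>1. q dvd mersenne m" if "h = 1 \<or> (\<exists>j. h = 2 ^ j)"
  proof -
    obtain j where "h = 2 ^ j"
      using \<open>h = 1 \<or> (\<exists>j. h = 2 ^ j)\<close> by (metis power_0)
    then have q_dvd: "q dvd mersenne (j + k)"
      using dvd by (simp add: mersenne_def power_add)
    have "j + k \<noteq> 1"
      using q_dvd assms(1) by (auto simp: mersenne_def)
    with k have "j + k > 1"
      by simp
    with q_dvd show ?thesis by blast
  qed
  with k dvd show ?thesis by blast
qed

end
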